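(* Let $f(x,y) = \binom{5}{2} x^3 y^2$ and let $K \subseteq \mathbb{C}$ be a field. Then $L_K(f) = 4$ if and only if $s(K) \le 2$; otherwise, $L_K(f) = 5$.
   Context: For a binary form (homogeneous polynomial) $f(x,y)$ of degree $d$ with coefficients in a field $K \subseteq \mathbb{C}$, the $K$-rank (or $K$-length) $L_K(f)$ is the smallest integer $r$ for which there is a representation $$f(x,y) = \sum_{j=1}^r \lambda_j(\alpha_j x + \beta_j y)^d$$ with $\lambda_j, \alpha_j, \beta_j \in K$ for all $j$. The Stufe $s(K)$ of a non-real field $K$ is the smallest integer $n$ such that $-1$ can be written as a sum of $n$ squares in $K$. The condition $s(K) \le 2$ means that there exist $r, s \in K$ with $r^2 + s^2 = -1$ (in particular it fails if $-1$ is not a sum of squares in $K$). *)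

theory Defs
  imports
    Complex_Main
    "HOL-Library.Extended_Nat"
    "HOL-Computational_Algebra.Polynomial"
    "HOL-Algebra.Algebraic_Closure_Type"
begin

text \<open>
  Subfields of the complex numbers are the sets \<open>K\<close> with
  \<open>subfield K (ring_of_type_algebra :: complex ring)\<close>. The next lemma spells this out in
  type-class terms.
\<close>

lemma subfield_complex_iff:
  fixes K :: "complex set"
  shows "subfield K (ring_of_type_algebra :: complex ring) \<longleftrightarrow>
    0 \<in> K \<and> 1 \<in> K \<and> (\<forall>a\<in>K. \<forall>b\<in>K. a - b \<in> K \<and> a * b \<in> K) \<and> (\<forall>a\<in>K. inverse a \<in> K)"
    (is "?L \<longleftrightarrow> ?R")
proof -
  let ?C = "ring_of_type_algebra :: complex ring"
  interpret C: field ?C by (rule field_from_type_algebra)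
  have sel: "carrier ?C = UNIV" "\<And>a b. a \<otimes>\<^bsub>?C\<^esub> b = a * b" "\<one>\<^bsub>?C\<^esub> = 1" "\<zero>\<^bsub>?C\<^esub> = 0"
    "\<And>a b. a \<oplus>\<^bsub>?C\<^esub> b = a + b"
    by (simp_all add: ring_of_type_algebra_def)
  have neg: "\<ominus>\<^bsub>?C\<^esub> a = - a" for a
    using C.minus_equality[of "- a" a] sel by simp
  have inv: "inv\<^bsub>?C\<^esub> a = inverse a" if "a \<noteq> 0" for a
    using C.comm_inv_char[of a "inverse a"] that sel by simp
  show ?thesis
  proof
    assume L: ?L
    then have S: "subring K ?C"
      by (simp add: subfieldE(1))
    note E = subringE[OF S, unfolded sel neg]
    have "a - b \<in> K" if "a \<in> K" "b \<in> K" for a b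
      using E(7)[of a "- b"] E(5)[of b] that by simp
    moreover have "inverse a \<in> K" if "a \<in> K" for a
    proof (cases "a = 0")
      case False
      then have "inv\<^bsub>?C\<^esub> a \<in> K"
        using C.subfield_m_inv(1)[OF L, of a] that sel(4) by simp
      then show ?thesis using inv False by simp
    qed (use that in simp)
    ultimately show ?R
      using E(2,3,6) by simp
  next
    assume R: ?R
    have m: "- a \<in> K" if "a \<in> K" for a
      using R that diff_0[of a] by metis
    have p: "a + b \<in> K" if "a \<in> K" "b \<in> K" for a b
      using R that m by (metis diff_minus_eq_add)
    show ?L
    proof (rule C.subfieldI')
      show "subring K ?C"
        by (rule C.subringI) (use R m p in \<open>simp_all add: sel neg\<close>)
      show "inv\<^bsub>?C\<^esub> k \<in> K" if "k \<in> K - {\<zero>\<^bsub>?C\<^esub>}" for k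
        using that R by (simp add: inv sel)
    qed
  qed
qed

text \<open>
  Binary forms are elements of \<open>\<complex>[x][y]\<close>, i.e. of type \<open>complex poly poly\<close>: the variable \<open>x\<close> lives
  in the inner and \<open>y\<close> in the outer polynomial ring.
\<close>

definition var_x :: "complex poly poly" where
  "var_x = [:[:0, 1:]:]"

definition var_y :: "complex poly poly" where
  "var_y = [:0, 1:]"

definition const :: "complex \<Rightarrow> complex poly poly" where
  "const c = [:[:c:]:]"

text \<open>
  The \<open>K\<close>-length of a form \<open>f\<close>; its degree \<open>d\<close> is an explicit argument. The infimum is taken in
  \<open>enat\<close>, so it is the least number of summands, or \<open>\<infinity>\<close> if there is no representation.
\<close>

definition form_length :: "complex set \<Rightarrow> nat \<Rightarrow> complex poly poly \<Rightarrow> enat" where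
  "form_length K d f = Inf {enat r | r. \<exists>l a b :: nat \<Rightarrow> complex.
     (\<forall>j<r. l j \<in> K \<and> a j \<in> K \<and> b j \<in> K) \<and>
     f = (\<Sum>j<r. const (l j) * (const (a j) * var_x + const (b j) * var_y) ^ d)}"

text \<open>
  The Stufe is \<open>\<infinity>\<close> if \<open>-1\<close> is not a sum of squares in \<open>K\<close>, so that \<open>stufe K \<le> 2\<close> then fails.
\<close>

definition stufe :: "complex set \<Rightarrow> enat" where
  "stufe K = Inf {enat n | n. \<exists>a :: nat \<Rightarrow> complex. (\<forall>j<n. a j \<in> K) \<and> (\<Sum>j<n. (a j)\<^sup>2) = - 1}"

end

theory Submission
  imports Defs
begin

text \<open>
  Comparing coefficients, \<open>10 x\<^sup>3 y\<^sup>2 = \<Sum> \<lambda>\<^sub>j (a\<^sub>j x + b\<^sub>j y)\<^sup>5\<close> says that the moments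
  \<open>M\<^sub>k = \<Sum> \<lambda>\<^sub>j a\<^sub>j^k b\<^sub>j^(5 - k)\<close> are \<open>1\<close> for \<open>k = 3\<close> and \<open>0\<close> otherwise. Following Sylvester, the form
  \<open>\<Prod>(b\<^sub>j x - a\<^sub>j y)\<close> vanishes at all the points \<open>(a\<^sub>j, b\<^sub>j)\<close> and hence yields linear relations between
  the moments. With three points they are contradictory. With four points they force all
  \<open>b\<^sub>j\<close> to be nonzero and the first two elementary symmetric functions of \<open>t\<^sub>j = a\<^sub>j / b\<^sub>j\<close> to vanish,
  which makes \<open>- (t\<^sub>1 + t\<^sub>2)\<^sup>2\<close> a sum of two squares. Conversely, \<open>p\<^sup>2 + q\<^sup>2 = -1\<close> yields four such
  \<open>t\<^sub>j\<close>; if they are distinct, the Lagrange weights \<open>1 / \<Prod>(t\<^sub>j - t\<^sub>i)\<close> solve the moment equations. They can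
  coincide only if \<open>-2\<close> is a square in the field, and then another point of the circle
  works. Over the rationals the points \<open>1, -1, 2, -2, \<infinity>\<close> always give a representation of length five.
\<close>

section \<open>Closure of subfields, the two infima, comparison of coefficients\<close>

lemma subfield_complex_closed:
  assumes "subfield K (ring_of_type_algebra :: complex ring)"
  shows "0 \<in> K" "1 \<in> K" "numeral n \<in> K"
    "a \<in> K \<Longrightarrow> - a \<in> K" "a \<in> K \<Longrightarrow> inverse a \<in> K"
    "a \<in> K \<Longrightarrow> b \<in> K \<Longrightarrow> a + b \<in> K" "a \<in> K \<Longrightarrow> b \<in> K \<Longrightarrow> a - b \<in> K"
    "a \<in> K \<Longrightarrow> b \<in> K \<Longrightarrow> a * b \<in> K" "a \<in> K \<Longrightarrow> b \<in> K \<Longrightarrow> a / b \<in> K"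
proof -
  have 0: "0 \<in> K" and 1: "1 \<in> K" and diff: "\<And>a b. a \<in> K \<Longrightarrow> b \<in> K \<Longrightarrow> a - b \<in> K"
    and mult: "\<And>a b. a \<in> K \<Longrightarrow> b \<in> K \<Longrightarrow> a * b \<in> K"
    and inv: "\<And>a. a \<in> K \<Longrightarrow> inverse a \<in> K"
    using assms by (auto simp: subfield_complex_iff)
  have neg: "- a \<in> K" if "a \<in> K" for a
    using diff[OF 0 that] by simp
  have add: "a + b \<in> K" if "a \<in> K" "b \<in> K" for a b
    using diff[OF that(1) neg[OF that(2)]] by simp
  have "of_nat m \<in> K" for m
    by (induction m) (auto intro: 0 1 add)
  from this[of "numeral n"] show "numeral n \<in> K" by simp
  show "a \<in> K \<Longrightarrow> - a \<in> K" "a \<in> K \<Longrightarrow> b \<in> K \<Longrightarrow> a + b \<in> K"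
    by (fact neg, fact add)
  show "a \<in> K \<Longrightarrow> b \<in> K \<Longrightarrow> a / b \<in> K"
    by (simp add: divide_inverse mult inv)
qed (use assms in \<open>auto simp: subfield_complex_iff\<close>)

lemma Inf_enat_Collect_le_iff: "Inf {enat r | r. P r} \<le> enat n \<longleftrightarrow> (\<exists>r\<le>n. P r)"
proof -
  \<comment> \<open>The strict form gives access to \<open>Inf_less_iff\<close>, which produces a
    witness even though the set may be empty.\<close>
  have "Inf {enat r | r. P r} \<le> enat n \<longleftrightarrow> Inf {enat r | r. P r} < enat (Suc n)"
    by (cases "Inf {enat r | r. P r}") auto
  also have "\<dots> \<longleftrightarrow> (\<exists>r\<le>n. P r)"
    unfolding Inf_less_iff by (fastforce simp: less_Suc_eq_le)
  finally show ?thesis .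
qed

text \<open>Padding with zero summands turns "at most \<open>n\<close>" into "exactly
  \<open>n\<close>". The weight 0 kills a summand for every \<open>d\<close>, including
  \<open>d = 0\<close>.\<close>

lemma form_length_le_iff:
  assumes "0 \<in> K"
  shows "form_length K d f \<le> enat n \<longleftrightarrow>
    (\<exists>l a b. (\<forall>j<n. l j \<in> K \<and> a j \<in> K \<and> b j \<in> K) \<and>
      f = (\<Sum>j<n. const (l j) * (const (a j) * var_x + const (b j) * var_y) ^ d))"
    (is "_ \<longleftrightarrow> (\<exists>l a b. ?rep n l a b)")
proof
  assume "form_length K d f \<le> enat n"
  then obtain r l a b where r: "r \<le> n" and rep: "?rep r l a b"
    unfolding form_length_def Inf_enat_Collect_le_iff by auto
  define l' a' b' where "l' = (\<lambda>j. if j < r then l j else 0)"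
    and "a' = (\<lambda>j. if j < r then a j else 0)" and "b' = (\<lambda>j. if j < r then b j else 0)"
  have "f = (\<Sum>j<n. const (l' j) * (const (a' j) * var_x + const (b' j) * var_y) ^ d)"
    unfolding rep[THEN conjunct2]
    by (rule sum.mono_neutral_cong_left)
      (use r in \<open>auto simp: l'_def a'_def b'_def const_def\<close>)
  moreover have "\<forall>j<n. l' j \<in> K \<and> a' j \<in> K \<and> b' j \<in> K"
    using rep assms by (auto simp: l'_def a'_def b'_def)
  ultimately show "\<exists>l a b. ?rep n l a b" by blast
next
  assume "\<exists>l a b. ?rep n l a b"
  then show "form_length K d f \<le> enat n"
    unfolding form_length_def Inf_enat_Collect_le_iff by blast
qed

lemma stufe_le_2_iff:
  assumes "0 \<in> K"
  shows "stufe K \<le> 2 \<longleftrightarrow> (\<exists>p\<in>K. \<exists>q\<in>K. p\<^sup>2 + q\<^sup>2 = - 1)"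
proof -
  have "stufe K \<le> 2 \<longleftrightarrow> (\<exists>n\<le>2::nat. \<exists>a. (\<forall>j<n. a j \<in> K) \<and> (\<Sum>j<n. (a j)\<^sup>2) = - 1)"
    unfolding stufe_def numeral_eq_enat Inf_enat_Collect_le_iff by simp
  also have "\<dots> \<longleftrightarrow> (\<exists>p\<in>K. \<exists>q\<in>K. p\<^sup>2 + q\<^sup>2 = - 1)"
  proof
    assume "\<exists>n\<le>2::nat. \<exists>a. (\<forall>j<n. a j \<in> K) \<and> (\<Sum>j<n. (a j)\<^sup>2) = - 1"
    then obtain n :: nat and a where a: "n \<le> 2" "\<forall>j<n. a j \<in> K" "(\<Sum>j<n. (a j)\<^sup>2) = - 1" by blast
    from a(1) consider "n = 0" | "n = 1" | "n = 2" by linarith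
    then show "\<exists>p\<in>K. \<exists>q\<in>K. p\<^sup>2 + q\<^sup>2 = - 1"
    proof cases
      case 2
      with a have "a 0 \<in> K" "(a 0)\<^sup>2 + 0\<^sup>2 = - 1" by auto
      with assms show ?thesis by blast
    next
      case 3
      with a have "a 0 \<in> K" "a 1 \<in> K" "(a 0)\<^sup>2 + (a 1)\<^sup>2 = - 1"
        by (auto simp: eval_nat_numeral)
      then show ?thesis by blast
    qed (use a in auto)
  next
    assume "\<exists>p\<in>K. \<exists>q\<in>K. p\<^sup>2 + q\<^sup>2 = - 1"
    then obtain p q where "p \<in> K" "q \<in> K" "p\<^sup>2 + q\<^sup>2 = - 1" by blast
    then show "\<exists>n\<le>2::nat. \<exists>a. (\<forall>j<n. a j \<in> K) \<and> (\<Sum>j<n. (a j)\<^sup>2) = - 1"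
      by (intro exI[of _ 2] conjI exI[of _ "\<lambda>j. if j = 0 then p else q"])
        (auto simp: numeral_2_eq_2)
  qed
  finally show ?thesis .
qed

text \<open>\<open>ck\<close> is the coefficient of \<open>x^k y^(5 - k)\<close> divided by \<open>5 choose k\<close>.\<close>

definition quintic ::
  "complex \<Rightarrow> complex \<Rightarrow> complex \<Rightarrow> complex \<Rightarrow> complex \<Rightarrow> complex \<Rightarrow> complex poly poly" where
  "quintic c0 c1 c2 c3 c4 c5 =
    [:[:0,0,0,0,0,c5:], [:0,0,0,0,5 * c4:], [:0,0,0,10 * c3:], [:0,0,10 * c2:], [:0,5 * c1:], [:c0:]:]"

lemma quintic_sum:
  fixes r :: nat
  shows "(\<Sum>j<r. quintic (c0 j) (c1 j) (c2 j) (c3 j) (c4 j) (c5 j)) =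
    quintic (\<Sum>j<r. c0 j) (\<Sum>j<r. c1 j) (\<Sum>j<r. c2 j) (\<Sum>j<r. c3 j) (\<Sum>j<r. c4 j) (\<Sum>j<r. c5 j)"
  by (induction r) (simp_all add: quintic_def algebra_simps)

lemma power_linear_form:
  "const l * (const a * var_x + const b * var_y) ^ 5 =
    quintic (l * b^5) (l * a * b^4) (l * a^2 * b^3) (l * a^3 * b^2) (l * a^4 * b) (l * a^5)"
  by (simp add: quintic_def const_def var_x_def var_y_def eval_nat_numeral algebra_simps)

lemma quintic_target: "of_nat (5 choose 2) * var_x ^ 3 * var_y ^ 2 = quintic 0 0 0 1 0 0"
proof -
  have "(5 choose 2 :: nat) = 10" by (simp add: eval_nat_numeral)
  then show ?thesis
    by (simp add: quintic_def var_x_def var_y_def eval_nat_numeral numeral_poly algebra_simps)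
qed

lemma quintic_target_eq_sum_iff:
  fixes r :: nat
  shows "of_nat (5 choose 2) * var_x ^ 3 * var_y ^ 2 =
    (\<Sum>j<r. const (l j) * (const (a j) * var_x + const (b j) * var_y) ^ 5) \<longleftrightarrow>
    (\<Sum>j<r. l j * b j ^ 5) = 0 \<and> (\<Sum>j<r. l j * a j * b j ^ 4) = 0 \<and>
    (\<Sum>j<r. l j * a j ^ 2 * b j ^ 3) = 0 \<and> (\<Sum>j<r. l j * a j ^ 3 * b j ^ 2) = 1 \<and>
    (\<Sum>j<r. l j * a j ^ 4 * b j) = 0 \<and> (\<Sum>j<r. l j * a j ^ 5) = 0"
  unfolding power_linear_form quintic_sum quintic_target
  by (auto simp: quintic_def)

(* HOL-Algebra hides the Groebner basis prover behind another one called algebra, hence the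
   qualified name below. *)

lemma no_three_points:
  fixes l1 l2 l3 a1 a2 a3 b1 b2 b3 :: "'a::field"
  assumes M0: "l1 * b1^5 + l2 * b2^5 + l3 * b3^5 = 0"
    and M1: "l1 * a1 * b1^4 + l2 * a2 * b2^4 + l3 * a3 * b3^4 = 0"
    and M2: "l1 * a1^2 * b1^3 + l2 * a2^2 * b2^3 + l3 * a3^2 * b3^3 = 0"
    and M3: "l1 * a1^3 * b1^2 + l2 * a2^3 * b2^2 + l3 * a3^3 * b3^2 = 1"
  shows False
proof -
  \<comment> \<open>The coefficients are those of the cubic vanishing at the three points. Only the
    M3 term survives, with value \<open>b1 * b2 * b3\<close>.\<close>
  have "b1 * b2 * b3 * (l1 * a1^3 * b1^2 + l2 * a2^3 * b2^2 + l3 * a3^3 * b3^2)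
      - (a1 * b2 * b3 + a2 * b1 * b3 + a3 * b1 * b2) *
        (l1 * a1^2 * b1^3 + l2 * a2^2 * b2^3 + l3 * a3^2 * b3^3)
      + (a1 * a2 * b3 + a1 * a3 * b2 + a2 * a3 * b1) *
        (l1 * a1 * b1^4 + l2 * a2 * b2^4 + l3 * a3 * b3^4)
      - a1 * a2 * a3 * (l1 * b1^5 + l2 * b2^5 + l3 * b3^5) = 0"
    by (simp add: algebra_simps eval_nat_numeral)
  then have three: "b1 * b2 * b3 = 0"
    unfolding M0 M1 M2 M3 by simp
  \<comment> \<open>Once some \<open>b\<close> is 0, its point drops out of M0 to M3, as each
    contains a positive power of \<open>b\<close>. The same argument then runs with the quadratic
    through the other two points, and finally with a single point.\<close>
  have two: "x * y = 0"
    if "l * x^4 * c + m * y^4 * d = 0" "l * c^2 * x^3 + m * d^2 * y^3 = 0"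
      "l * c^3 * x^2 + m * d^3 * y^2 = 1" for l m c d x y :: 'a
    using that by Groebner_Basis.algebra
  have one: False if "l * c^2 * x^3 = 0" "l * c^3 * x^2 = 1" for l c x :: 'a
    using that by auto
  consider "b1 = 0" | "b2 = 0" | "b3 = 0" using three by auto
  then show False
  proof cases
    case 1
    then have "b2 * b3 = 0" using M1 M2 M3 two[of l2 b2 a2 l3 b3 a3] by (simp add: mult_ac)
    then show False using 1 M2 M3 one[of l2 a2 b2] one[of l3 a3 b3] by auto
  next
    case 2
    then have "b1 * b3 = 0" using M1 M2 M3 two[of l1 b1 a1 l3 b3 a3] by (simp add: mult_ac)
    then show False using 2 M2 M3 one[of l1 a1 b1] one[of l3 a3 b3] by auto
  next
    case 3
    then have "b1 * b2 = 0" using M1 M2 M3 two[of l1 b1 a1 l2 b2 a2] by (simp add: mult_ac)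
    then show False using 3 M2 M3 one[of l1 a1 b1] one[of l2 a2 b2] by auto
  qed
qed

text \<open>Weighting the j-th quartic equation by \<open>lj * aj\<close> and summing leaves only
  \<open>e2\<close> times M3; weighting by \<open>lj * bj\<close> leaves only \<open>- e1\<close>
  times M3. Both sums are linear in the coefficients, which therefore stay variables here.\<close>

lemma quartic_relations:
  fixes l1 l2 l3 l4 a1 a2 a3 a4 b1 b2 b3 b4 e0 e1 e2 e3 e4 :: "'a::field"
  assumes "e0 * a1^4 - e1 * a1^3 * b1 + e2 * a1^2 * b1^2 - e3 * a1 * b1^3 + e4 * b1^4 = 0"
    and "e0 * a2^4 - e1 * a2^3 * b2 + e2 * a2^2 * b2^2 - e3 * a2 * b2^3 + e4 * b2^4 = 0"
    and "e0 * a3^4 - e1 * a3^3 * b3 + e2 * a3^2 * b3^2 - e3 * a3 * b3^3 + e4 * b3^4 = 0"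
    and "e0 * a4^4 - e1 * a4^3 * b4 + e2 * a4^2 * b4^2 - e3 * a4 * b4^3 + e4 * b4^4 = 0"
    and "l1 * b1^5 + l2 * b2^5 + l3 * b3^5 + l4 * b4^5 = 0"
    and "l1 * a1 * b1^4 + l2 * a2 * b2^4 + l3 * a3 * b3^4 + l4 * a4 * b4^4 = 0"
    and "l1 * a1^2 * b1^3 + l2 * a2^2 * b2^3 + l3 * a3^2 * b3^3 + l4 * a4^2 * b4^3 = 0"
    and "l1 * a1^3 * b1^2 + l2 * a2^3 * b2^2 + l3 * a3^3 * b3^2 + l4 * a4^3 * b4^2 = 1"
    and "l1 * a1^4 * b1 + l2 * a2^4 * b2 + l3 * a3^4 * b3 + l4 * a4^4 * b4 = 0"
    and "l1 * a1^5 + l2 * a2^5 + l3 * a3^5 + l4 * a4^5 = 0"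
  shows "e1 = 0" "e2 = 0"
  using assms by Groebner_Basis.algebra+

lemma four_points_symmetric:
  fixes l1 l2 l3 l4 a1 a2 a3 a4 b1 b2 b3 b4 :: "'a::field"
  assumes "l1 * b1^5 + l2 * b2^5 + l3 * b3^5 + l4 * b4^5 = 0"
    and "l1 * a1 * b1^4 + l2 * a2 * b2^4 + l3 * a3 * b3^4 + l4 * a4 * b4^4 = 0"
    and "l1 * a1^2 * b1^3 + l2 * a2^2 * b2^3 + l3 * a3^2 * b3^3 + l4 * a4^2 * b4^3 = 0"
    and "l1 * a1^3 * b1^2 + l2 * a2^3 * b2^2 + l3 * a3^3 * b3^2 + l4 * a4^3 * b4^2 = 1"
    and "l1 * a1^4 * b1 + l2 * a2^4 * b2 + l3 * a3^4 * b3 + l4 * a4^4 * b4 = 0"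
    and "l1 * a1^5 + l2 * a2^5 + l3 * a3^5 + l4 * a4^5 = 0"
  shows "a1 * b2 * b3 * b4 + a2 * b1 * b3 * b4 + a3 * b1 * b2 * b4 + a4 * b1 * b2 * b3 = 0"
      (is "?e1 = 0")
    and "a1 * a2 * b3 * b4 + a1 * a3 * b2 * b4 + a1 * a4 * b2 * b3 +
      a2 * a3 * b1 * b4 + a2 * a4 * b1 * b3 + a3 * a4 * b1 * b2 = 0" (is "?e2 = 0")
proof -
  \<comment> \<open>With \<open>?e1\<close> and \<open>?e2\<close> these are, up to sign, the
    coefficients of the product of the four linear forms. At each point one factor is 0, whence
    \<open>r1\<close> to \<open>r4\<close>.\<close>
  let ?e0 = "b1 * b2 * b3 * b4" and ?e4 = "a1 * a2 * a3 * a4"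
  let ?e3 = "a1 * a2 * a3 * b4 + a1 * a2 * a4 * b3 + a1 * a3 * a4 * b2 + a2 * a3 * a4 * b1"
  have r1: "?e0 * a1^4 - ?e1 * a1^3 * b1 + ?e2 * a1^2 * b1^2 - ?e3 * a1 * b1^3 + ?e4 * b1^4 = 0"
    by Groebner_Basis.algebra
  have r2: "?e0 * a2^4 - ?e1 * a2^3 * b2 + ?e2 * a2^2 * b2^2 - ?e3 * a2 * b2^3 + ?e4 * b2^4 = 0"
    by Groebner_Basis.algebra
  have r3: "?e0 * a3^4 - ?e1 * a3^3 * b3 + ?e2 * a3^2 * b3^2 - ?e3 * a3 * b3^3 + ?e4 * b3^4 = 0"
    by Groebner_Basis.algebra
  have r4: "?e0 * a4^4 - ?e1 * a4^3 * b4 + ?e2 * a4^2 * b4^2 - ?e3 * a4 * b4^3 + ?e4 * b4^4 = 0"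
    by Groebner_Basis.algebra
  show "?e1 = 0" "?e2 = 0"
    by (fact quartic_relations[OF r1 r2 r3 r4 assms])+
qed

text \<open>A point with \<open>b = 0\<close> contributes nothing to M0 to M3, so the other three
  would contradict \<open>no_three_points\<close>.\<close>

lemma four_points_nonzero:
  fixes l1 l2 l3 l4 a1 a2 a3 a4 b1 b2 b3 b4 :: "'a::field"
  assumes M0: "l1 * b1^5 + l2 * b2^5 + l3 * b3^5 + l4 * b4^5 = 0"
    and M1: "l1 * a1 * b1^4 + l2 * a2 * b2^4 + l3 * a3 * b3^4 + l4 * a4 * b4^4 = 0"
    and M2: "l1 * a1^2 * b1^3 + l2 * a2^2 * b2^3 + l3 * a3^2 * b3^3 + l4 * a4^2 * b4^3 = 0"
    and M3: "l1 * a1^3 * b1^2 + l2 * a2^3 * b2^2 + l3 * a3^3 * b3^2 + l4 * a4^3 * b4^2 = 1"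
  shows "b1 \<noteq> 0" "b2 \<noteq> 0" "b3 \<noteq> 0" "b4 \<noteq> 0"
  using assms no_three_points[of l2 b2 l3 b3 l4 b4 a2 a3 a4]
    no_three_points[of l1 b1 l3 b3 l4 b4 a1 a3 a4]
    no_three_points[of l1 b1 l2 b2 l4 b4 a1 a2 a4]
    no_three_points[of l1 b1 l2 b2 l3 b3 a1 a2 a3] by auto

section \<open>Four-point configurations and sums of two squares\<close>

lemma two_squares_of_symmetric:
  fixes t1 t2 t3 t4 :: complex
  assumes K: "subfield K (ring_of_type_algebra :: complex ring)"
    and t: "t1 \<in> K" "t2 \<in> K" "t3 \<in> K" "t4 \<in> K"
    and e1: "t1 + t2 + t3 + t4 = 0"
    and e2: "t1 * t2 + t1 * t3 + t1 * t4 + t2 * t3 + t2 * t4 + t3 * t4 = 0"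
    and nz: "\<not> (t1 = 0 \<and> t2 = 0 \<and> t3 = 0 \<and> t4 = 0)"
  shows "\<exists>p\<in>K. \<exists>q\<in>K. p\<^sup>2 + q\<^sup>2 = - 1"
proof (cases "t1 + t2 = 0")
  case False
  \<comment> \<open>For \<open>s = t1 + t2\<close>, the hypotheses give
    \<open>(t1 - t2)^2 + (t3 - t4)^2 = - 2 * s^2\<close>. Half the sum and half the difference of
    \<open>t1 - t2\<close> and \<open>t3 - t4\<close> absorb the factor 2.\<close>
  define v w where "v = (t1 - t2 + (t3 - t4)) / 2" and "w = (t1 - t2 - (t3 - t4)) / 2"
  have v: "2 * v = t1 - t2 + (t3 - t4)" and w: "2 * w = t1 - t2 - (t3 - t4)"
    by (simp_all add: v_def w_def)
  have "4 * (v\<^sup>2 + w\<^sup>2) = (2 * v)\<^sup>2 + (2 * w)\<^sup>2" by (simp add: power2_eq_square)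
  also have "\<dots> = 4 * (0 - (t1 + t2)\<^sup>2)"
    unfolding v w using e1 e2 by Groebner_Basis.algebra
  finally have vw: "v\<^sup>2 + w\<^sup>2 = - (t1 + t2)\<^sup>2" by Groebner_Basis.algebra
  have "(v / (t1 + t2))\<^sup>2 + (w / (t1 + t2))\<^sup>2 = (v\<^sup>2 + w\<^sup>2) / (t1 + t2)\<^sup>2"
    by (simp add: power_divide add_divide_distrib)
  also have "\<dots> = - 1" using vw False by simp
  finally have "(v / (t1 + t2))\<^sup>2 + (w / (t1 + t2))\<^sup>2 = - 1" .
  moreover have "v / (t1 + t2) \<in> K" "w / (t1 + t2) \<in> K"
    unfolding v_def w_def by (intro subfield_complex_closed[OF K] t)+
  ultimately show ?thesis by blast
next
  case True
  \<comment> \<open>The points form two opposite pairs, and \<open>e2\<close> makes -1 itself a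
    square.\<close>
  then have t2: "t2 = - t1" and t4: "t4 = - t3" using e1 by Groebner_Basis.algebra+
  have sq: "t3\<^sup>2 = - t1\<^sup>2" using e2 unfolding t2 t4 by Groebner_Basis.algebra
  then have "t1 \<noteq> 0" using nz t2 t4 by auto
  then have "(t3 / t1)\<^sup>2 + 0\<^sup>2 = - 1"
    using sq by (simp add: power_divide)
  then show ?thesis
    using subfield_complex_closed(1)[OF K] subfield_complex_closed(9)[OF K t(3,1)] by blast
qed

lemma distinct_symmetric_points:
  assumes K: "subfield K (ring_of_type_algebra :: complex ring)"
    and "p \<in> K" "q \<in> K" "p\<^sup>2 + q\<^sup>2 = - 1"
  obtains t1 t2 t3 t4 where "t1 \<in> K" "t2 \<in> K" "t3 \<in> K" "t4 \<in> K" "distinct [t1, t2, t3, t4]"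
    "t1 + t2 + t3 + t4 = 0"
    "t1 * t2 + t1 * t3 + t1 * t4 + t2 * t3 + t2 * t4 + t3 * t4 = 0"
proof -
  note closed = subfield_complex_closed[OF K] and thesisI = that
  have good: thesis if "p \<in> K" "q \<in> K" and pq: "p\<^sup>2 + q\<^sup>2 = - 1"
    and ne: "p\<^sup>2 \<noteq> 1" "q\<^sup>2 \<noteq> 1" "p\<^sup>2 \<noteq> q\<^sup>2" for p q
  proof (rule thesisI)
    \<comment> \<open>This inverts the construction of \<open>v\<close> and \<open>w\<close> above,
      normalised to \<open>t1 + t2 = 2\<close>. Up to the factor 2 the differences are
      \<open>p + q\<close>, \<open>1 + q\<close>, \<open>1 + p\<close>, \<open>1 - p\<close>,
      \<open>1 - q\<close>, \<open>p - q\<close>, so \<open>ne\<close> is exactly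
      distinctness.\<close>
    let ?t1 = "1 + (p + q)" and ?t2 = "1 - (p + q)" and ?t3 = "- 1 + (p - q)" and ?t4 = "- 1 - (p - q)"
    show "?t1 \<in> K" "?t2 \<in> K" "?t3 \<in> K" "?t4 \<in> K"
      using that by (auto intro!: closed)
    have "?t1 \<noteq> ?t2" using ne by Groebner_Basis.algebra
    moreover have "?t1 \<noteq> ?t3" using ne by Groebner_Basis.algebra
    moreover have "?t1 \<noteq> ?t4" using ne by Groebner_Basis.algebra
    moreover have "?t2 \<noteq> ?t3" using ne by Groebner_Basis.algebra
    moreover have "?t2 \<noteq> ?t4" using ne by Groebner_Basis.algebra
    moreover have "?t3 \<noteq> ?t4" using ne by Groebner_Basis.algebra
    ultimately show "distinct [?t1, ?t2, ?t3, ?t4]" by simp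
    show "?t1 + ?t2 + ?t3 + ?t4 = 0" by simp
    show "?t1 * ?t2 + ?t1 * ?t3 + ?t1 * ?t4 + ?t2 * ?t3 + ?t2 * ?t4 + ?t3 * ?t4 = 0"
      using pq by Groebner_Basis.algebra
  qed
  have root: thesis if "z \<in> K" and z: "z\<^sup>2 = - 2" for z
  proof -
    \<comment> \<open>The point \<open>(1, z)\<close> lies on the circle; it is rotated by the
      rational 3-4-5 rotation. Any coincidence of the new squares would make \<open>z\<close>
      rational.\<close>
    let ?p = "(3 + 4 * z) / 5" and ?q = "(3 * z - 4) / 5"
    have p: "?p\<^sup>2 = (24 * z - 23) / 25" and q: "?q\<^sup>2 = (- 24 * z - 2) / 25"
      by (simp_all add: power_divide power2_sum power2_diff power_mult_distrib z)
    show thesis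
    proof (rule good)
      show "?p \<in> K" "?q \<in> K" using that by (auto intro!: closed)
      show "?p\<^sup>2 + ?q\<^sup>2 = - 1" unfolding p q by (simp add: field_simps)
      show "?p\<^sup>2 \<noteq> 1" "?q\<^sup>2 \<noteq> 1" "?p\<^sup>2 \<noteq> ?q\<^sup>2"
        unfolding p q using z by Groebner_Basis.algebra+
    qed
  qed
  show thesis
  proof (cases "p\<^sup>2 = 1 \<or> q\<^sup>2 = 1 \<or> p\<^sup>2 = q\<^sup>2")
    case False
    then show thesis using good assms by blast
  next
    case True
    then consider "p\<^sup>2 = 1" | "q\<^sup>2 = 1" | "p\<^sup>2 = q\<^sup>2" by blast
    then show thesis
    proof cases
      case 1
      then have "q\<^sup>2 = - 2" using assms(4) by Groebner_Basis.algebra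
      then show thesis using root assms by blast
    next
      case 2
      then have "p\<^sup>2 = - 2" using assms(4) by Groebner_Basis.algebra
      then show thesis using root assms by blast
    next
      case 3
      then have "(2 * p)\<^sup>2 = - 2" using assms(4) by Groebner_Basis.algebra
      then show thesis using root[OF closed(8)[OF closed(3) assms(2)]] by blast
    qed
  qed
qed

text \<open>
  The weights are \<open>1 / \<Prod>(t\<^sub>j - t\<^sub>i)\<close>, written over the common denominator \<open>V\<close>. Since
  \<open>t\<^sub>j\<^sup>4 = e\<^sub>3 t\<^sub>j - e\<^sub>4\<close>, the fourth and fifth power sums reduce to lower ones.
\<close>

lemma lagrange_weights:
  fixes t1 t2 t3 t4 :: "'a::field"
  assumes dist: "distinct [t1, t2, t3, t4]"
    and e1: "t1 + t2 + t3 + t4 = 0"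
    and e2: "t1 * t2 + t1 * t3 + t1 * t4 + t2 * t3 + t2 * t4 + t3 * t4 = 0"
  defines "V \<equiv> (t1 - t2) * (t1 - t3) * (t1 - t4) * (t2 - t3) * (t2 - t4) * (t3 - t4)"
  defines "l1 \<equiv> (t2 - t3) * (t2 - t4) * (t3 - t4) / V"
    and "l2 \<equiv> - ((t1 - t3) * (t1 - t4) * (t3 - t4)) / V"
    and "l3 \<equiv> (t1 - t2) * (t1 - t4) * (t2 - t4) / V"
    and "l4 \<equiv> - ((t1 - t2) * (t1 - t3) * (t2 - t3)) / V"
  shows "l1 + l2 + l3 + l4 = 0"
    "l1 * t1 + l2 * t2 + l3 * t3 + l4 * t4 = 0"
    "l1 * t1^2 + l2 * t2^2 + l3 * t3^2 + l4 * t4^2 = 0"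
    "l1 * t1^3 + l2 * t2^3 + l3 * t3^3 + l4 * t4^3 = 1"
    "l1 * t1^4 + l2 * t2^4 + l3 * t3^4 + l4 * t4^4 = 0"
    "l1 * t1^5 + l2 * t2^5 + l3 * t3^5 + l4 * t4^5 = 0"
proof -
  have V: "V \<noteq> 0" using dist by (simp add: V_def)
  define n1 n2 n3 n4 where "n1 = (t2 - t3) * (t2 - t4) * (t3 - t4)"
    and "n2 = - ((t1 - t3) * (t1 - t4) * (t3 - t4))"
    and "n3 = (t1 - t2) * (t1 - t4) * (t2 - t4)"
    and "n4 = - ((t1 - t2) * (t1 - t3) * (t2 - t3))"
  note n = n1_def n2_def n3_def n4_def
  have l: "l1 = n1 / V" "l2 = n2 / V" "l3 = n3 / V" "l4 = n4 / V"
    by (simp_all add: l1_def l2_def l3_def l4_def n)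
  \<comment> \<open>Clearing \<open>V\<close> leaves polynomial identities. Up to cubes they express
    third divided differences of \<open>t^k\<close>: 0 for \<open>k < 3\<close>, and 1 for
    \<open>k = 3\<close>.\<close>
  have combine: "l1 * x1 + l2 * x2 + l3 * x3 + l4 * x4 = c"
    if "n1 * x1 + n2 * x2 + n3 * x3 + n4 * x4 = V * c" for x1 x2 x3 x4 c
  proof -
    have "l1 * x1 + l2 * x2 + l3 * x3 + l4 * x4 = (n1 * x1 + n2 * x2 + n3 * x3 + n4 * x4) / V"
      by (simp add: l add_divide_distrib)
    then show ?thesis using that V by simp
  qed
  have "n1 * 1 + n2 * 1 + n3 * 1 + n4 * 1 = V * 0" unfolding n by Groebner_Basis.algebra
  from combine[OF this] show s0: "l1 + l2 + l3 + l4 = 0" by simp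
  show s1: "l1 * t1 + l2 * t2 + l3 * t3 + l4 * t4 = 0"
    by (rule combine) (unfold n, Groebner_Basis.algebra)
  show s2: "l1 * t1^2 + l2 * t2^2 + l3 * t3^2 + l4 * t4^2 = 0"
    by (rule combine) (unfold n, Groebner_Basis.algebra)
  show "l1 * t1^3 + l2 * t2^3 + l3 * t3^3 + l4 * t4^3 = 1"
    by (rule combine) (unfold n V_def, Groebner_Basis.algebra)
  let ?e3 = "t1 * t2 * t3 + t1 * t2 * t4 + t1 * t3 * t4 + t2 * t3 * t4" and ?e4 = "t1 * t2 * t3 * t4"
  have q: "t1^4 = ?e3 * t1 - ?e4" "t2^4 = ?e3 * t2 - ?e4" "t3^4 = ?e3 * t3 - ?e4" "t4^4 = ?e3 * t4 - ?e4"
    using e1 e2 by Groebner_Basis.algebra+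
  have "l1 * t1^4 + l2 * t2^4 + l3 * t3^4 + l4 * t4^4 =
    ?e3 * (l1 * t1 + l2 * t2 + l3 * t3 + l4 * t4) - ?e4 * (l1 + l2 + l3 + l4)"
    unfolding q by Groebner_Basis.algebra
  then show "l1 * t1^4 + l2 * t2^4 + l3 * t3^4 + l4 * t4^4 = 0"
    unfolding s0 s1 by simp
  have "l1 * t1^5 + l2 * t2^5 + l3 * t3^5 + l4 * t4^5 =
    l1 * t1 * t1^4 + l2 * t2 * t2^4 + l3 * t3 * t3^4 + l4 * t4 * t4^4"
    by Groebner_Basis.algebra
  also have "\<dots> = ?e3 * (l1 * t1^2 + l2 * t2^2 + l3 * t3^2 + l4 * t4^2) -
    ?e4 * (l1 * t1 + l2 * t2 + l3 * t3 + l4 * t4)"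
    unfolding q by Groebner_Basis.algebra
  finally show "l1 * t1^5 + l2 * t2^5 + l3 * t3^5 + l4 * t4^5 = 0"
    unfolding s1 s2 by simp
qed

section \<open>The length of the form\<close>

theorem theorem4p1:
  fixes K :: "complex set" and f :: "complex poly poly"
  assumes "subfield K (ring_of_type_algebra :: complex ring)"
    and "f = of_nat (5 choose 2) * var_x ^ 3 * var_y ^ 2"
  shows "(form_length K 5 f = 4 \<longleftrightarrow> stufe K \<le> 2) \<and>
         (\<not> stufe K \<le> 2 \<longrightarrow> form_length K 5 f = 5)"
proof -
  note K = assms(1)
  note closed = subfield_complex_closed[OF K]
  note rep_iff = form_length_le_iff[OF closed(1), of 5 f, unfolded assms(2) quintic_target_eq_sum_iff,
      folded assms(2)]
  note stufe_iff = stufe_le_2_iff[OF closed(1)]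
  have sum3: "(\<Sum>j<3. g j) = g 0 + g 1 + g 2" for g :: "nat \<Rightarrow> complex"
    by (simp add: eval_nat_numeral)
  have sum4: "(\<Sum>j<4. g j) = g 0 + g 1 + g 2 + g 3" for g :: "nat \<Rightarrow> complex"
    by (simp add: eval_nat_numeral)
  have sum5: "(\<Sum>j<5. g j) = g 0 + g 1 + g 2 + g 3 + g 4" for g :: "nat \<Rightarrow> complex"
    by (simp add: eval_nat_numeral)
  have lower: "\<not> form_length K 5 f \<le> enat 3"
    unfolding rep_iff sum3 by (blast dest: no_three_points)
  \<comment> \<open>The first four weights are the Lagrange weights at 2, -2, 1, -1. They give the
    right M0 to M3, and M4 vanishes by symmetry, but M5 is 5. The point at infinity
    \<open>(1, 0)\<close> enters only M5, and its weight -5 cancels this.\<close>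
  have "(\<forall>j<5::nat. [1/12, -1/12, -1/6, 1/6, -5] ! j \<in> K \<and> [2, -2, 1, -1, 1] ! j \<in> K \<and>
    [1, 1, 1, 1, 0] ! j \<in> K)"
    by (auto simp: less_Suc_eq eval_nat_numeral intro!: closed)
  then have upper: "form_length K 5 f \<le> enat 5"
    unfolding rep_iff
    by (intro exI[of _ "\<lambda>j. [1/12, -1/12, -1/6, 1/6, -5] ! j"] exI[of _ "\<lambda>j. [2, -2, 1, -1, 1] ! j"]
        exI[of _ "\<lambda>j. [1, 1, 1, 1, 0] ! j"]) (simp add: sum5)
  have four: "form_length K 5 f \<le> enat 4 \<longleftrightarrow> stufe K \<le> 2"
  proof
    assume "form_length K 5 f \<le> enat 4"
    then obtain l a b where ab: "\<forall>j<4::nat. l j \<in> K \<and> a j \<in> K \<and> b j \<in> K" and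
      M: "l 0 * b 0 ^ 5 + l 1 * b 1 ^ 5 + l 2 * b 2 ^ 5 + l 3 * b 3 ^ 5 = 0"
      "l 0 * a 0 * b 0 ^ 4 + l 1 * a 1 * b 1 ^ 4 + l 2 * a 2 * b 2 ^ 4 + l 3 * a 3 * b 3 ^ 4 = 0"
      "l 0 * a 0 ^ 2 * b 0 ^ 3 + l 1 * a 1 ^ 2 * b 1 ^ 3 + l 2 * a 2 ^ 2 * b 2 ^ 3 + l 3 * a 3 ^ 2 * b 3 ^ 3 = 0"
      "l 0 * a 0 ^ 3 * b 0 ^ 2 + l 1 * a 1 ^ 3 * b 1 ^ 2 + l 2 * a 2 ^ 3 * b 2 ^ 2 + l 3 * a 3 ^ 3 * b 3 ^ 2 = 1"
      "l 0 * a 0 ^ 4 * b 0 + l 1 * a 1 ^ 4 * b 1 + l 2 * a 2 ^ 4 * b 2 + l 3 * a 3 ^ 4 * b 3 = 0"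
      "l 0 * a 0 ^ 5 + l 1 * a 1 ^ 5 + l 2 * a 2 ^ 5 + l 3 * a 3 ^ 5 = 0"
      unfolding rep_iff sum4 by blast
    note nz = four_points_nonzero[OF M(1-4)]
    note e = four_points_symmetric[OF M]
    have "\<exists>p\<in>K. \<exists>q\<in>K. p\<^sup>2 + q\<^sup>2 = - 1"
    proof (rule two_squares_of_symmetric[OF K])
      define t where "t j = a j / b j" for j
      have a: "a 0 = t 0 * b 0" "a 1 = t 1 * b 1" "a 2 = t 2 * b 2" "a 3 = t 3 * b 3"
        using nz by (simp_all add: t_def)
      show "t 0 \<in> K" "t 1 \<in> K" "t 2 \<in> K" "t 3 \<in> K"
        using ab by (auto simp: t_def intro!: closed)
      have "(t 0 + t 1 + t 2 + t 3) * (b 0 * b 1 * b 2 * b 3) = 0"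
        using e(1) unfolding a by Groebner_Basis.algebra
      then show "t 0 + t 1 + t 2 + t 3 = 0"
        using nz by simp
      have "(t 0 * t 1 + t 0 * t 2 + t 0 * t 3 + t 1 * t 2 + t 1 * t 3 + t 2 * t 3) *
        (b 0 * b 1 * b 2 * b 3) = 0"
        using e(2) unfolding a by Groebner_Basis.algebra
      then show "t 0 * t 1 + t 0 * t 2 + t 0 * t 3 + t 1 * t 2 + t 1 * t 3 + t 2 * t 3 = 0"
        using nz by simp
      \<comment> \<open>If all \<open>t j\<close> were 0, then M3 would be 0 instead of 1.\<close>
      show "\<not> (t 0 = 0 \<and> t 1 = 0 \<and> t 2 = 0 \<and> t 3 = 0)"
        using M(4) unfolding a by auto
    qed
    then show "stufe K \<le> 2" using stufe_iff by blast
  next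
    assume "stufe K \<le> 2"
    then obtain p q where "p \<in> K" "q \<in> K" "p\<^sup>2 + q\<^sup>2 = - 1" using stufe_iff by blast
    then obtain t1 t2 t3 t4 where t: "t1 \<in> K" "t2 \<in> K" "t3 \<in> K" "t4 \<in> K"
      and "distinct [t1, t2, t3, t4]" "t1 + t2 + t3 + t4 = 0"
      "t1 * t2 + t1 * t3 + t1 * t4 + t2 * t3 + t2 * t4 + t3 * t4 = 0"
      by (rule distinct_symmetric_points[OF K])
    note L = lagrange_weights[OF this(5-7)]
    define V where "V = (t1 - t2) * (t1 - t3) * (t1 - t4) * (t2 - t3) * (t2 - t4) * (t3 - t4)"
    define l where "l = [(t2 - t3) * (t2 - t4) * (t3 - t4) / V,
      - ((t1 - t3) * (t1 - t4) * (t3 - t4)) / V,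
      (t1 - t2) * (t1 - t4) * (t2 - t4) / V,
      - ((t1 - t2) * (t1 - t3) * (t2 - t3)) / V]"
    have "V \<in> K" unfolding V_def by (intro closed t)
    then have "set l \<subseteq> K"
      unfolding l_def by (auto simp del: minus_diff_eq intro!: closed t)
    then have "\<forall>j<4::nat. l ! j \<in> K \<and> [t1, t2, t3, t4] ! j \<in> K \<and> 1 \<in> K"
      using t closed by (auto simp: l_def less_Suc_eq eval_nat_numeral)
    moreover have "l ! 0 + l ! 1 + l ! 2 + l ! 3 = 0"
      "l ! 0 * t1 + l ! 1 * t2 + l ! 2 * t3 + l ! 3 * t4 = 0"
      "l ! 0 * t1^2 + l ! 1 * t2^2 + l ! 2 * t3^2 + l ! 3 * t4^2 = 0"
      "l ! 0 * t1^3 + l ! 1 * t2^3 + l ! 2 * t3^3 + l ! 3 * t4^3 = 1"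
      "l ! 0 * t1^4 + l ! 1 * t2^4 + l ! 2 * t3^4 + l ! 3 * t4^4 = 0"
      "l ! 0 * t1^5 + l ! 1 * t2^5 + l ! 2 * t3^5 + l ! 3 * t4^5 = 0"
      using L[folded V_def] by (simp_all add: l_def)
    ultimately show "form_length K 5 f \<le> enat 4"
      unfolding rep_iff sum4
      by (intro exI[of _ "\<lambda>j. l ! j"] exI[of _ "\<lambda>j. [t1, t2, t3, t4] ! j"] exI[of _ "\<lambda>_. 1"]) simp
  qed
  show ?thesis
    using lower upper four
    by (cases "form_length K 5 f") (auto simp: numeral_eq_enat)
qed

end
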